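(* Let $A$ and $B$ be von Neumann algebras and let $f:A\to B$ be a unital $\ast$-homomorphism. The natural transformation $\underline{\Sigma}(\underline{f}):F^{\ast}\underline{\Sigma}_{B}\to\underline{\Sigma}_{A}$ given by $$\underline{\Sigma}(\underline{f})_{C}:\Sigma_{f[C]}\to\Sigma_{C},\qquad\lambda\mapsto\lambda\circ f|_{C}\qquad(C\in\mathcal{C}_A)$$ is a continuous map of topological spaces in $[\mathcal{C}^{op}_{A},\mathbf{Set}]$.
   Context: For a von Neumann algebra $A$, $\mathcal{C}_A$ is the poset (under inclusion) of abelian von Neumann subalgebras of $A$ (containing the unit), and $\mathcal{C}_A^{\downarrow}$ is $\mathcal{C}_A$ with the topology of downward closed subsets; $[\mathcal{C}_A^{op},\mathbf{Set}]\cong Sh(\mathcal{C}_A^{\downarrow})$. $\Sigma_C$ is the Gelfand spectrum of $C$. The spectral presheaf $\underline{\Sigma}_A$ is $C\mapsto\Sigma_C$ with restriction maps $\lambda\mapsto\lambda|_D$ for $D\subseteq C$. The $\ast$-homomorphism $f$ is taken to induce the order-preserving map $\hat{f}:\mathcal{C}_A\to\mathcal{C}_B$, $\hat f(C)=f[C]$, and $F:[\mathcal{C}_A^{op},\mathbf{Set}]\to[\mathcal{C}_B^{op},\mathbf{Set}]$ is the geometric morphism induced by $\hat f$, whose inverse image functor $F^{\ast}$ is precomposition with $\hat f$; so $F^{\ast}\underline{\Sigma}_B(C)=\Sigma_{f[C]}$. Internal topologies: a presheaf $\underline{X}$ on $\mathcal{C}_A$ corresponds to the étale bundle $p:X=\coprod_C\underline{X}(C)\to\mathcal{C}_A^{\downarrow}$,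 where $U\subseteq X$ is étale open iff $(C,x)\in U$ and $D\subseteq C$ imply $(D,x|_D)\in U$. Internal topologies on $\underline{X}$ correspond to topologies on $X$ coarser than the étale topology for which $p$ is continuous. A natural transformation $\underline{X}\to\underline{Y}$ is internally continuous iff the induced function $X\to Y$ is continuous for these coarser topologies. The internal topology on $\underline{\Sigma}_A$ (generated by the clopen subobjects) corresponds to the topology on $\coprod_{C\in\mathcal{C}_A}\Sigma_C$ whose opens are the étale opens $U$ with $U\cap\Sigma_C$ open in $\Sigma_C$ for all $C$. The internal topology on $F^{\ast}\underline{\Sigma}_B$ corresponds to the topology on $\coprod_{C\in\mathcal{C}_A}\Sigma_{f[C]}$ whose opens are the sets $U$ such that (1) $(C,\lambda)\in U$ and $C'\subseteq C$ imply $(C',\lambda|_{f[C']})\in U$, and (2) $U\cap\Sigma_{f[C]}$ is open in $\Sigma_{f[C]}$ for every $C\in\mathcal{C}_A$. *)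

theory Defs
  imports "HOL-Analysis.Analysis"
begin

section \<open>Complex Hilbert spaces and bounded operators\<close>

text \<open>The inner product is linear in its second argument. Its real part is the
  real inner product of the class \<open>real_inner\<close>, so norm, topology and completeness are
  those of the complex inner product.\<close>

class complex_hilbert = real_inner + complete_space +
  fixes scaleC :: "complex \<Rightarrow> 'a \<Rightarrow> 'a"  (infixr "*\<^sub>C" 75)
    and cinner :: "'a \<Rightarrow> 'a \<Rightarrow> complex"
  assumes scaleC_add_right: "c *\<^sub>C (x + y) = c *\<^sub>C x + c *\<^sub>C y"
    and scaleC_add_left: "(c + d) *\<^sub>C x = c *\<^sub>C x + d *\<^sub>C x"
    and scaleC_scaleC: "c *\<^sub>C (d *\<^sub>C x) = (c * d) *\<^sub>C x"
    and scaleC_of_real: "complex_of_real r *\<^sub>C x = r *\<^sub>R x"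
    and cinner_commute: "cinner x y = cnj (cinner y x)"
    and cinner_add_right: "cinner x (y + z) = cinner x y + cinner x z"
    and cinner_scaleC_right: "cinner x (c *\<^sub>C y) = c * cinner x y"
    and Re_cinner: "Re (cinner x y) = inner x y"

lemma norm_scaleC: "norm (c *\<^sub>C x) = cmod c * norm (x :: 'h::complex_hilbert)"
proof -
  have left: "cinner (c *\<^sub>C x) y = cnj c * cinner x y" for y
    by (metis cinner_commute cinner_scaleC_right complex_cnj_mult)
  have "cinner (c *\<^sub>C x) (c *\<^sub>C x) = (c * cnj c) * cinner x x"
    by (simp add: left cinner_scaleC_right ac_simps)
  also have "c * cnj c = complex_of_real ((cmod c)\<^sup>2)"
    using complex_norm_square[of c] by simp
  finally have "inner (c *\<^sub>C x) (c *\<^sub>C x) = (cmod c)\<^sup>2 * inner x x"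
    by (simp flip: Re_cinner)
  then show ?thesis
    by (simp add: norm_eq_sqrt_inner real_sqrt_mult)
qed

lemma bounded_linear_scaleC: "bounded_linear (\<lambda>x::'h::complex_hilbert. c *\<^sub>C x)"
proof (rule bounded_linear_intro[where K = "cmod c"])
  show "c *\<^sub>C (r *\<^sub>R x) = r *\<^sub>R (c *\<^sub>C x)" for r and x :: 'h
    by (simp add: scaleC_scaleC mult.commute flip: scaleC_of_real)
qed (simp_all add: scaleC_add_right norm_scaleC mult.commute)

typedef (overloaded) 'h bop =
  "{T :: 'h::complex_hilbert \<Rightarrow> 'h. bounded_linear T \<and> (\<forall>c x. T (c *\<^sub>C x) = c *\<^sub>C T x)}"
  morphisms apply_bop Bop
  by (rule exI[of _ "\<lambda>x. x"]) (simp add: bounded_linear_ident)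

setup_lifting type_definition_bop

instantiation bop :: (complex_hilbert) "{ring, monoid_mult}"
begin

lift_definition zero_bop :: "'a bop" is "\<lambda>x. 0"
  using scaleC_add_right[of _ "0::'a" 0] by simp

lift_definition one_bop :: "'a bop" is "\<lambda>x. x"
  by (simp add: bounded_linear_ident)

lift_definition plus_bop :: "'a bop \<Rightarrow> 'a bop \<Rightarrow> 'a bop" is "\<lambda>S T x. S x + T x"
  by (simp add: bounded_linear_add scaleC_add_right)

lift_definition uminus_bop :: "'a bop \<Rightarrow> 'a bop" is "\<lambda>T x. - T x"
  by (auto simp: bounded_linear_minus linear_neg[OF bounded_linear.linear[OF bounded_linear_scaleC]])

lift_definition minus_bop :: "'a bop \<Rightarrow> 'a bop \<Rightarrow> 'a bop" is "\<lambda>S T x. S x - T x"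
  by (auto simp: bounded_linear_sub linear_diff[OF bounded_linear.linear[OF bounded_linear_scaleC]])

lift_definition times_bop :: "'a bop \<Rightarrow> 'a bop \<Rightarrow> 'a bop" is "\<lambda>S T x. S (T x)"
  by (auto intro: bounded_linear_compose)

instance
  by standard
    (transfer; auto simp: linear_add[OF bounded_linear.linear] fun_eq_iff algebra_simps)+

end

lift_definition scale_bop :: "complex \<Rightarrow> 'h::complex_hilbert bop \<Rightarrow> 'h bop" is "\<lambda>c T x. c *\<^sub>C T x"
  by (auto intro: bounded_linear_compose[OF bounded_linear_scaleC] simp: scaleC_scaleC mult.commute)

text \<open>The operator described exists by the Riesz representation theorem.\<close>

definition adj :: "'h::complex_hilbert bop \<Rightarrow> 'h bop" where
  "adj T = (THE S. \<forall>x y. cinner (apply_bop S x) y = cinner x (apply_bop T y))"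


section \<open>Von Neumann algebras\<close>

definition star_subalgebra :: "'h::complex_hilbert bop set \<Rightarrow> bool" where
  "star_subalgebra M \<longleftrightarrow> 1 \<in> M \<and>
     (\<forall>S\<in>M. \<forall>T\<in>M. S + T \<in> M \<and> S * T \<in> M) \<and>
     (\<forall>c. \<forall>T\<in>M. scale_bop c T \<in> M) \<and>
     (\<forall>T\<in>M. adj T \<in> M)"

definition commutant :: "'h::complex_hilbert bop set \<Rightarrow> 'h bop set" where
  "commutant M = {T. \<forall>S\<in>M. T * S = S * T}"

definition von_neumann_algebra :: "'h::complex_hilbert bop set \<Rightarrow> bool" where
  "von_neumann_algebra M \<longleftrightarrow> star_subalgebra M \<and> commutant (commutant M) = M"

text \<open>The poset \<open>\<C>\<^sub>A\<close>; its order is inclusion, that is, \<open>\<le>\<close> on sets.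
  Every von Neumann algebra contains the identity operator, so \<open>C\<close> and \<open>A\<close> have the same unit.\<close>

definition abelian_subalgebras :: "'h::complex_hilbert bop set \<Rightarrow> 'h bop set set" where
  "abelian_subalgebras A =
     {C. C \<subseteq> A \<and> von_neumann_algebra C \<and> (\<forall>S\<in>C. \<forall>T\<in>C. S * T = T * S)}"

definition unital_star_hom ::
    "'h::complex_hilbert bop set \<Rightarrow> 'k::complex_hilbert bop set \<Rightarrow> ('h bop \<Rightarrow> 'k bop) \<Rightarrow> bool" where
  "unital_star_hom A B f \<longleftrightarrow> f \<in> A \<rightarrow> B \<and> f 1 = 1 \<and>
     (\<forall>S\<in>A. \<forall>T\<in>A. f (S + T) = f S + f T \<and> f (S * T) = f S * f T) \<and>
     (\<forall>c. \<forall>T\<in>A. f (scale_bop c T) = scale_bop c (f T)) \<and>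
     (\<forall>T\<in>A. f (adj T) = adj (f T))"


section \<open>Gelfand spectrum\<close>

text \<open>Characters of \<open>C\<close> are functions on \<open>C\<close>, represented by total functions that are
  \<^const>\<open>undefined\<close> outside \<open>C\<close>.\<close>

definition gelfand_spectrum :: "'h::complex_hilbert bop set \<Rightarrow> ('h bop \<Rightarrow> complex) set" where
  "gelfand_spectrum C = {\<mu> \<in> extensional C.
     (\<forall>S\<in>C. \<forall>T\<in>C. \<mu> (S + T) = \<mu> S + \<mu> T \<and> \<mu> (S * T) = \<mu> S * \<mu> T) \<and>
     (\<forall>c. \<forall>T\<in>C. \<mu> (scale_bop c T) = c * \<mu> T) \<and>
     (\<exists>T\<in>C. \<mu> T \<noteq> 0)}"

text \<open>The topology of pointwise convergence on \<open>C\<close>, i.e. the weak-* topology.\<close>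

definition gelfand_topology :: "'h::complex_hilbert bop set \<Rightarrow> ('h bop \<Rightarrow> complex) topology" where
  "gelfand_topology C = subtopology (product_topology (\<lambda>_. euclidean) C) (gelfand_spectrum C)"


section \<open>Presheaves on a poset and their internal topologies\<close>

text \<open>In a presheaf \<open>X\<close>, \<open>restr X C D\<close> is the restriction map
  \<open>sections X C \<rightarrow> sections X D\<close> for \<open>D \<le> C\<close>.\<close>

record ('p, 'x) presheaf =
  base :: "'p set"
  sections :: "'p \<Rightarrow> 'x set"
  restr :: "'p \<Rightarrow> 'p \<Rightarrow> 'x \<Rightarrow> 'x"

definition is_presheaf :: "('p::order, 'x) presheaf \<Rightarrow> bool" where
  "is_presheaf X \<longleftrightarrow>
     (\<forall>C\<in>base X. \<forall>D\<in>base X. D \<le> C \<longrightarrow> restr X C D \<in> sections X C \<rightarrow> sections X D) \<and>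
     (\<forall>C\<in>base X. \<forall>x\<in>sections X C. restr X C C x = x) \<and>
     (\<forall>C\<in>base X. \<forall>D\<in>base X. \<forall>E\<in>base X. E \<le> D \<longrightarrow> D \<le> C \<longrightarrow>
        (\<forall>x\<in>sections X C. restr X D E (restr X C D x) = restr X C E x))"

definition natural_transformation ::
    "('p::order, 'x) presheaf \<Rightarrow> ('p, 'y) presheaf \<Rightarrow> ('p \<Rightarrow> 'x \<Rightarrow> 'y) \<Rightarrow> bool" where
  "natural_transformation X Y \<eta> \<longleftrightarrow>
     is_presheaf X \<and> is_presheaf Y \<and> base X = base Y \<and>
     (\<forall>C\<in>base X. \<eta> C \<in> sections X C \<rightarrow> sections Y C) \<and>
     (\<forall>C\<in>base X. \<forall>D\<in>base X. D \<le> C \<longrightarrow>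
        (\<forall>x\<in>sections X C. \<eta> D (restr X C D x) = restr Y C D (\<eta> C x)))"

text \<open>The inverse image functor \<open>F\<^sup>*\<close> of the geometric morphism \<open>F : [P\<^sup>o\<^sup>p, Set] \<rightarrow> [Q\<^sup>o\<^sup>p, Set]\<close>
  induced by an order-preserving map \<open>\<phi> : P \<rightarrow> Q\<close>, where \<open>Q\<close> is the base of \<open>X\<close>.\<close>

definition inverse_image :: "'p set \<Rightarrow> ('p \<Rightarrow> 'q) \<Rightarrow> ('q, 'x) presheaf \<Rightarrow> ('p, 'x) presheaf" where
  "inverse_image P \<phi> X =
     \<lparr>base = P, sections = (\<lambda>C. sections X (\<phi> C)), restr = (\<lambda>C D. restr X (\<phi> C) (\<phi> D))\<rparr>"

definition downset_topology :: "'p::order set \<Rightarrow> 'p topology" where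
  "downset_topology P = topology (\<lambda>U. U \<subseteq> P \<and> (\<forall>C\<in>U. \<forall>D\<in>P. D \<le> C \<longrightarrow> D \<in> U))"

lemma openin_downset_topology:
  "openin (downset_topology P) U \<longleftrightarrow> U \<subseteq> P \<and> (\<forall>C\<in>U. \<forall>D\<in>P. D \<le> C \<longrightarrow> D \<in> U)"
proof -
  have "istopology (\<lambda>U. U \<subseteq> P \<and> (\<forall>C\<in>U. \<forall>D\<in>P. D \<le> C \<longrightarrow> D \<in> U))"
    unfolding istopology_def by blast
  then show ?thesis
    by (simp add: downset_topology_def)
qed

definition total_space :: "('p, 'x) presheaf \<Rightarrow> ('p \<times> 'x) set" where
  "total_space X = Sigma (base X) (sections X)"

definition etale_topology :: "('p::order, 'x) presheaf \<Rightarrow> ('p \<times> 'x) topology" where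
  "etale_topology X = topology (\<lambda>U. U \<subseteq> total_space X \<and>
     (\<forall>(C, x)\<in>U. \<forall>D\<in>base X. D \<le> C \<longrightarrow> (D, restr X C D x) \<in> U))"

lemma openin_etale_topology:
  "openin (etale_topology X) U \<longleftrightarrow> U \<subseteq> total_space X \<and>
     (\<forall>(C, x)\<in>U. \<forall>D\<in>base X. D \<le> C \<longrightarrow> (D, restr X C D x) \<in> U)"
proof -
  have "istopology (\<lambda>U. U \<subseteq> total_space X \<and>
     (\<forall>(C, x)\<in>U. \<forall>D\<in>base X. D \<le> C \<longrightarrow> (D, restr X C D x) \<in> U))"
    unfolding istopology_def by fast
  then show ?thesis
    by (simp add: etale_topology_def)
qed

definition internal_topology :: "('p::order, 'x) presheaf \<Rightarrow> ('p \<times> 'x) topology \<Rightarrow> bool" where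
  "internal_topology X T \<longleftrightarrow> is_presheaf X \<and> topspace T = total_space X \<and>
     (\<forall>U. openin T U \<longrightarrow> openin (etale_topology X) U) \<and>
     continuous_map T (downset_topology (base X)) fst"

definition internally_continuous ::
    "('p::order, 'x) presheaf \<Rightarrow> ('p \<times> 'x) topology \<Rightarrow>
     ('p, 'y) presheaf \<Rightarrow> ('p \<times> 'y) topology \<Rightarrow> ('p \<Rightarrow> 'x \<Rightarrow> 'y) \<Rightarrow> bool" where
  "internally_continuous X S Y T \<eta> \<longleftrightarrow>
     internal_topology X S \<and> internal_topology Y T \<and> natural_transformation X Y \<eta> \<and>
     continuous_map S T (\<lambda>(C, x). (C, \<eta> C x))"

text \<open>The topology whose opens are the etale opens that meet each fibre \<open>sections X C\<close>
  in an open set of the space \<open>\<tau> C\<close>.\<close>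

definition fibrewise_topology ::
    "('p::order, 'x) presheaf \<Rightarrow> ('p \<Rightarrow> 'x topology) \<Rightarrow> ('p \<times> 'x) topology" where
  "fibrewise_topology X \<tau> = topology (\<lambda>U. openin (etale_topology X) U \<and>
     (\<forall>C\<in>base X. openin (\<tau> C) {x. (C, x) \<in> U}))"

lemma openin_fibrewise_topology:
  "openin (fibrewise_topology X \<tau>) U \<longleftrightarrow> openin (etale_topology X) U \<and>
     (\<forall>C\<in>base X. openin (\<tau> C) {x. (C, x) \<in> U})"
proof -
  have "istopology (\<lambda>U. openin (etale_topology X) U \<and>
     (\<forall>C\<in>base X. openin (\<tau> C) {x. (C, x) \<in> U}))"
    unfolding istopology_def
  proof (intro conjI allI impI ballI)
    fix S T C
    assume "openin (etale_topology X) S \<and> (\<forall>C\<in>base X. openin (\<tau> C) {x. (C, x) \<in> S})"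
      and "openin (etale_topology X) T \<and> (\<forall>C\<in>base X. openin (\<tau> C) {x. (C, x) \<in> T})"
      and "C \<in> base X"
    then have "openin (\<tau> C) ({x. (C, x) \<in> S} \<inter> {x. (C, x) \<in> T})"
      by blast
    then show "openin (\<tau> C) {x. (C, x) \<in> S \<inter> T}"
      by (simp add: Int_def)
  next
    fix K C
    assume "\<forall>U\<in>K. openin (etale_topology X) U \<and> (\<forall>C\<in>base X. openin (\<tau> C) {x. (C, x) \<in> U})"
      and "C \<in> base X"
    then have "openin (\<tau> C) (\<Union>U\<in>K. {x. (C, x) \<in> U})"
      by blast
    moreover have "(\<Union>U\<in>K. {x. (C, x) \<in> U}) = {x. (C, x) \<in> \<Union>K}"
      by blast
    ultimately show "openin (\<tau> C) {x. (C, x) \<in> \<Union>K}"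
      by simp
  qed auto
  then show ?thesis
    by (simp add: fibrewise_topology_def)
qed


section \<open>The spectral presheaf\<close>

definition spectral_presheaf ::
    "'h::complex_hilbert bop set \<Rightarrow> ('h bop set, 'h bop \<Rightarrow> complex) presheaf" where
  "spectral_presheaf A =
     \<lparr>base = abelian_subalgebras A, sections = gelfand_spectrum, restr = (\<lambda>C D \<mu>. restrict \<mu> D)\<rparr>"

text \<open>\<open>F\<^sup>*\<close> of the spectral presheaf of \<open>B\<close>, for the map \<open>C \<mapsto> f[C]\<close> from \<open>\<C>\<^sub>A\<close> to \<open>\<C>\<^sub>B\<close>.\<close>

definition pulled_back_spectral_presheaf ::
    "'h::complex_hilbert bop set \<Rightarrow> 'k::complex_hilbert bop set \<Rightarrow> ('h bop \<Rightarrow> 'k bop) \<Rightarrow>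
     ('h bop set, 'k bop \<Rightarrow> complex) presheaf" where
  "pulled_back_spectral_presheaf A B f =
     inverse_image (abelian_subalgebras A) (\<lambda>C. f ` C) (spectral_presheaf B)"

definition spectral_topology ::
    "'h::complex_hilbert bop set \<Rightarrow> ('h bop set \<times> ('h bop \<Rightarrow> complex)) topology" where
  "spectral_topology A = fibrewise_topology (spectral_presheaf A) gelfand_topology"

definition pulled_back_spectral_topology ::
    "'h::complex_hilbert bop set \<Rightarrow> 'k::complex_hilbert bop set \<Rightarrow> ('h bop \<Rightarrow> 'k bop) \<Rightarrow>
     ('h bop set \<times> ('k bop \<Rightarrow> complex)) topology" where
  "pulled_back_spectral_topology A B f =
     fibrewise_topology (pulled_back_spectral_presheaf A B f) (\<lambda>C. gelfand_topology (f ` C))"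

end

theory Submission
  imports Defs
begin

text \<open>The topologies involved have as opens the etale opens that are open in every fibre, so
  continuity of the total map splits in two: preimages of etale opens are etale open by
  naturality, and fibrewise openness is continuity of the components. The components are
  continuous because evaluation of \<open>\<mu> \<circ> f\<close> at \<open>T\<close> is evaluation of \<open>\<mu>\<close> at \<open>f T\<close>.\<close>

lemma restr_in_sections:
  "is_presheaf X \<Longrightarrow> C \<in> base X \<Longrightarrow> D \<in> base X \<Longrightarrow> D \<le> C \<Longrightarrow> x \<in> sections X C \<Longrightarrow>
    restr X C D x \<in> sections X D"
  unfolding is_presheaf_def by blast

text \<open>The total space is itself open: restriction maps keep points inside it, and by the
  second hypothesis its fibre over \<open>C\<close> is the whole space
  \<open>\<tau> C\<close>.\<close>

lemma topspace_fibrewise_topology: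
  assumes "is_presheaf X" and "\<And>C. C \<in> base X \<Longrightarrow> topspace (\<tau> C) = sections X C"
  shows "topspace (fibrewise_topology X \<tau>) = total_space X"
proof
  show "topspace (fibrewise_topology X \<tau>) \<subseteq> total_space X"
    using openin_topspace[of "fibrewise_topology X \<tau>"]
    unfolding openin_fibrewise_topology openin_etale_topology by (elim conjE)
  have "openin (etale_topology X) (total_space X)"
    using restr_in_sections[OF assms(1)] by (auto simp: openin_etale_topology total_space_def)
  moreover have "openin (\<tau> C) {x. (C, x) \<in> total_space X}" if "C \<in> base X" for C
    using that openin_topspace[of "\<tau> C"] by (simp add: total_space_def assms(2))
  ultimately show "total_space X \<subseteq> topspace (fibrewise_topology X \<tau>)"
    by (intro openin_subset) (simp add: openin_fibrewise_topology)
qed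

text \<open>The opens are etale open by construction, so what remains is continuity of the
  projection. The preimage of a downset is closed under restriction, because restricting moves to a
  smaller base point, and each of its fibres is either empty or a whole space.\<close>

lemma internal_topology_fibrewise_topology:
  assumes X: "is_presheaf X" and \<tau>: "\<And>C. C \<in> base X \<Longrightarrow> topspace (\<tau> C) = sections X C"
  shows "internal_topology X (fibrewise_topology X \<tau>)"
proof -
  have top: "topspace (fibrewise_topology X \<tau>) = total_space X"
    using X \<tau> by (rule topspace_fibrewise_topology)
  have "continuous_map (fibrewise_topology X \<tau>) (downset_topology (base X)) fst"
    unfolding continuous_map_def
  proof (intro conjI allI impI)
    \<comment> \<open>The base is a downset in itself, so all its points lie in the topspace of the
      downset topology.\<close>
    have "openin (downset_topology (base X)) (base X)"
      by (simp add: openin_downset_topology)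
    then show "fst \<in> topspace (fibrewise_topology X \<tau>) \<rightarrow> topspace (downset_topology (base X))"
      using openin_subset by (fastforce simp: top total_space_def)
  next
    fix U assume U: "openin (downset_topology (base X)) U"
    let ?V = "{p \<in> topspace (fibrewise_topology X \<tau>). fst p \<in> U}"
    have "openin (etale_topology X) ?V"
      using U restr_in_sections[OF X]
      by (auto simp: openin_etale_topology openin_downset_topology top total_space_def)
    moreover have "openin (\<tau> C) {x. (C, x) \<in> ?V}" if "C \<in> base X" for C
      using that openin_topspace[of "\<tau> C"] by (cases "C \<in> U") (simp_all add: top total_space_def \<tau>)
    ultimately show "openin (fibrewise_topology X \<tau>) ?V"
      by (simp add: openin_fibrewise_topology)
  qed
  then show ?thesis
    using X top by (simp add: internal_topology_def openin_fibrewise_topology)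
qed

lemma internally_continuous_fibrewise_topology:
  assumes nat: "natural_transformation X Y \<eta>"
    and \<sigma>: "\<And>C. C \<in> base X \<Longrightarrow> topspace (\<sigma> C) = sections X C"
    and \<tau>: "\<And>C. C \<in> base Y \<Longrightarrow> topspace (\<tau> C) = sections Y C"
    and cont: "\<And>C. C \<in> base X \<Longrightarrow> continuous_map (\<sigma> C) (\<tau> C) (\<eta> C)"
  shows "internally_continuous X (fibrewise_topology X \<sigma>) Y (fibrewise_topology Y \<tau>) \<eta>"
proof -
  have X: "is_presheaf X" and Y: "is_presheaf Y" and base: "base Y = base X"
    using nat by (simp_all add: natural_transformation_def)
  have sec: "\<eta> C x \<in> sections Y C" if "C \<in> base X" "x \<in> sections X C" for C x
    using nat that unfolding natural_transformation_def by blast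
  have natural: "\<eta> D (restr X C D x) = restr Y C D (\<eta> C x)"
    if "C \<in> base X" "D \<in> base X" "D \<le> C" "x \<in> sections X C" for C D x
    using nat that by (simp add: natural_transformation_def)
  have topX: "topspace (fibrewise_topology X \<sigma>) = total_space X"
    using X \<sigma> by (rule topspace_fibrewise_topology)
  have topY: "topspace (fibrewise_topology Y \<tau>) = total_space Y"
    using Y \<tau> by (rule topspace_fibrewise_topology)
  let ?h = "\<lambda>(C, x). (C, \<eta> C x)"
  have "internal_topology X (fibrewise_topology X \<sigma>)"
    using X \<sigma> by (rule internal_topology_fibrewise_topology)
  moreover have "internal_topology Y (fibrewise_topology Y \<tau>)"
    using Y \<tau> by (rule internal_topology_fibrewise_topology)
  moreover have "continuous_map (fibrewise_topology X \<sigma>) (fibrewise_topology Y \<tau>) ?h"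
    unfolding continuous_map_def
  proof (intro conjI allI impI)
    show "?h \<in> topspace (fibrewise_topology X \<sigma>) \<rightarrow> topspace (fibrewise_topology Y \<tau>)"
      using sec by (auto simp: topX topY total_space_def base)
  next
    fix U assume U: "openin (fibrewise_topology Y \<tau>) U"
    let ?V = "{p \<in> topspace (fibrewise_topology X \<sigma>). ?h p \<in> U}"
    have step: "(D, restr Y C D y) \<in> U" if "(C, y) \<in> U" "D \<in> base X" "D \<le> C" for C D y
      using U that by (auto simp: openin_fibrewise_topology openin_etale_topology base)
    \<comment> \<open>By naturality \<open>?h\<close> sends the restriction of a point of
      \<open>?V\<close> to the restriction of its image, which \<open>step\<close> keeps in
      \<open>U\<close>.\<close>
    have "openin (etale_topology X) ?V"
      unfolding openin_etale_topology using step
      by (auto simp: topX total_space_def natural restr_in_sections[OF X])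
    moreover have "openin (\<sigma> C) {x. (C, x) \<in> ?V}" if C: "C \<in> base X" for C
    proof -
      have "openin (\<tau> C) {y. (C, y) \<in> U}"
        using U C by (simp add: openin_fibrewise_topology base)
      then have "openin (\<sigma> C) {x \<in> topspace (\<sigma> C). \<eta> C x \<in> {y. (C, y) \<in> U}}"
        by (rule openin_continuous_map_preimage[OF cont[OF C]])
      then show ?thesis
        using C by (simp add: topX total_space_def \<sigma>)
    qed
    ultimately show "openin (fibrewise_topology X \<sigma>) ?V"
      by (simp add: openin_fibrewise_topology)
  qed
  ultimately show ?thesis
    using nat by (simp add: internally_continuous_def)
qed

lemma is_presheaf_inverse_image:
  assumes "is_presheaf X" and "\<phi> \<in> P \<rightarrow> base X"
    and "\<And>C D. C \<in> P \<Longrightarrow> D \<in> P \<Longrightarrow> D \<le> C \<Longrightarrow> \<phi> D \<le> \<phi> C"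
  shows "is_presheaf (inverse_image P \<phi> X)"
proof -
  have "\<phi> C \<in> base X" if "C \<in> P" for C
    using assms(2) that by blast
  then show ?thesis
    using assms(1,3) by (simp add: is_presheaf_def inverse_image_def)
qed

text \<open>The codomain shrinks to the image of \<open>C\<close> because the characters to be
  pulled back live on that image only.\<close>

lemma unital_star_hom_subalgebra:
  assumes "unital_star_hom A B f" and "C \<subseteq> A"
  shows "unital_star_hom C (f ` C) f"
  using assms by (auto simp: unital_star_hom_def subset_iff)

text \<open>Characters are extensional on \<open>C\<close>, hence points of the product over
  \<open>C\<close>, so passing to the subspace loses none of them.\<close>

lemma topspace_gelfand_topology [simp]: "topspace (gelfand_topology C) = gelfand_spectrum C"
  by (auto simp: gelfand_topology_def topspace_subtopology gelfand_spectrum_def PiE_def)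

text \<open>Serves twice: for the components of the natural transformation, and with
  \<open>f = id\<close> for the restriction maps of the spectral presheaf.\<close>

lemma pullback_in_gelfand_spectrum:
  assumes D: "star_subalgebra D" and f: "unital_star_hom D C f" and \<mu>: "\<mu> \<in> gelfand_spectrum C"
  shows "restrict (\<mu> \<circ> f) D \<in> gelfand_spectrum D"
proof -
  have one: "1 \<in> D" "f 1 = 1"
    using D f unfolding star_subalgebra_def unital_star_hom_def by blast+
  \<comment> \<open>\<open>C\<close> is an arbitrary set of operators here; it contains the unit as
    the image of the unit of \<open>D\<close>.\<close>
  then have one': "1 \<in> C"
    using f unfolding unital_star_hom_def by (metis PiE)
  obtain T where T: "T \<in> C" "\<mu> T \<noteq> 0"
    using \<mu> unfolding gelfand_spectrum_def by blast
  \<comment> \<open>A character is nonzero at \<open>1\<close>, so its pullback is not the zero functional.\<close>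
  have "\<mu> (T * 1) = \<mu> T * \<mu> 1"
    using \<mu> T one' unfolding gelfand_spectrum_def by blast
  then have "\<mu> (f 1) \<noteq> 0"
    using T one by auto
  then have "\<exists>T\<in>D. restrict (\<mu> \<circ> f) D T \<noteq> 0"
    using one by (intro bexI[of _ 1]) auto
  moreover have "f T \<in> C" if "T \<in> D" for T
    using f that unfolding unital_star_hom_def by blast
  ultimately show ?thesis
    using D f \<mu> by (simp add: gelfand_spectrum_def star_subalgebra_def unital_star_hom_def)
qed

lemma continuous_map_pullback_gelfand:
  assumes D: "star_subalgebra D" and f: "unital_star_hom D C f"
  shows "continuous_map (gelfand_topology C) (gelfand_topology D) (\<lambda>\<mu>. restrict (\<mu> \<circ> f) D)"
proof -
  have "continuous_map (gelfand_topology C) euclidean (\<lambda>\<mu>. restrict (\<mu> \<circ> f) D T)" if "T \<in> D" for T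
  proof -
    have "f T \<in> C"
      using f that unfolding unital_star_hom_def by blast
    then have "continuous_map (gelfand_topology C) euclidean (\<lambda>\<mu>. \<mu> (f T))"
      unfolding gelfand_topology_def
      by (intro continuous_map_from_subtopology continuous_map_product_projection)
    then show ?thesis
      using that by simp
  qed
  \<comment> \<open>A map into a product is continuous when its coordinates are; passing to the
    subspace of characters then only requires the values to be characters.\<close>
  then have "continuous_map (gelfand_topology C) (product_topology (\<lambda>_. euclidean) D)
      (\<lambda>\<mu>. restrict (\<mu> \<circ> f) D)"
    by (auto simp: continuous_map_componentwise)
  then show ?thesis
    using pullback_in_gelfand_spectrum[OF D f]
    by (subst (2) gelfand_topology_def) (auto simp: continuous_map_in_subtopology)
qed

lemma star_subalgebra_abelian_subalgebras: "C \<in> abelian_subalgebras A \<Longrightarrow> star_subalgebra C"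
  by (simp add: abelian_subalgebras_def von_neumann_algebra_def)

lemma is_presheaf_spectral_presheaf: "is_presheaf (spectral_presheaf A)"
proof -
  have "restrict \<mu> D \<in> gelfand_spectrum D"
    if "D \<in> abelian_subalgebras A" "D \<subseteq> C" "\<mu> \<in> gelfand_spectrum C" for C D and \<mu> :: "'a bop \<Rightarrow> complex"
    \<comment> \<open>Restriction to \<open>D\<close> is pullback along the inclusion of
      \<open>D\<close> in \<open>C\<close>.\<close>
    using pullback_in_gelfand_spectrum[of D C id \<mu>] that star_subalgebra_abelian_subalgebras[of D A]
    by (auto simp: unital_star_hom_def Pi_iff)
  then show ?thesis
    \<comment> \<open>Restricting a character to its own algebra changes nothing because it is
      extensional; successive restrictions restrict to an intersection, here the smallest
      algebra.\<close>
    by (auto simp: is_presheaf_def spectral_presheaf_def Int_absorb1 Int_absorb2 gelfand_spectrum_def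
        intro: extensional_restrict)
qed

theorem proposition5p11:
  fixes A :: "'h::complex_hilbert bop set"
    and B :: "'k::complex_hilbert bop set"
    and f :: "'h bop \<Rightarrow> 'k bop"
  assumes "von_neumann_algebra A"
    and "von_neumann_algebra B"
    and "unital_star_hom A B f"
    and "\<forall>C\<in>abelian_subalgebras A. f ` C \<in> abelian_subalgebras B"
  shows "internally_continuous
           (pulled_back_spectral_presheaf A B f) (pulled_back_spectral_topology A B f)
           (spectral_presheaf A) (spectral_topology A)
           (\<lambda>C \<mu>. restrict (\<mu> \<circ> f) C)"
proof -
  let ?X = "pulled_back_spectral_presheaf A B f"
  have hom: "unital_star_hom C (f ` C) f" and star: "star_subalgebra C"
    if "C \<in> abelian_subalgebras A" for C
    using that unital_star_hom_subalgebra[OF assms(3)] star_subalgebra_abelian_subalgebras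
    by (auto simp: abelian_subalgebras_def)
  have X: "base ?X = abelian_subalgebras A" "sections ?X = (\<lambda>C. gelfand_spectrum (f ` C))"
    "restr ?X = (\<lambda>C D \<mu>. restrict \<mu> (f ` D))"
    by (simp_all add: pulled_back_spectral_presheaf_def inverse_image_def spectral_presheaf_def)
  have Y: "base (spectral_presheaf A) = abelian_subalgebras A"
    "sections (spectral_presheaf A) = gelfand_spectrum"
    "restr (spectral_presheaf A) = (\<lambda>C D \<mu>. restrict \<mu> D)"
    by (simp_all add: spectral_presheaf_def)
  \<comment> \<open>The last assumption of the theorem places the images in the base of the presheaf
    of \<open>B\<close>; taking images preserves inclusion.\<close>
  have "is_presheaf ?X"
    unfolding pulled_back_spectral_presheaf_def using assms(4)
    by (intro is_presheaf_inverse_image is_presheaf_spectral_presheaf)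
      (auto simp: spectral_presheaf_def)
  \<comment> \<open>Naturality: \<open>f\<close> maps \<open>D\<close> into its image, where the
    inner restriction changes nothing, so both sides are \<open>\<mu> \<circ> f\<close> on
    \<open>D\<close> and \<open>undefined\<close> elsewhere.\<close>
  moreover have "restrict (restrict \<mu> (f ` D) \<circ> f) D = restrict (restrict (\<mu> \<circ> f) C) D"
    if "D \<subseteq> C" for C D and \<mu> :: "'k bop \<Rightarrow> complex"
    using that by (auto simp: restrict_def fun_eq_iff)
  ultimately have "natural_transformation ?X (spectral_presheaf A) (\<lambda>C \<mu>. restrict (\<mu> \<circ> f) C)"
    using is_presheaf_spectral_presheaf pullback_in_gelfand_spectrum[OF star hom]
    by (auto simp: natural_transformation_def X Y)
  then show ?thesis
    unfolding pulled_back_spectral_topology_def spectral_topology_def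
    by (rule internally_continuous_fibrewise_topology)
      (simp_all add: X Y continuous_map_pullback_gelfand[OF star hom])
qed

end
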